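(* Let $w\in S_n$, and regard $D^w$ as a polynomial in $x_1,\dots,x_n$ (so $\mathrm{Newton}(D^w)\subseteq\mathbb{R}^n$). Then $\mathrm{Newton}(D^w)$ is the generalized permutahedron $P_n^z(\{z_I\}_{I\subseteq[n]})$ with \[z_I=\sum_{(a,b)\in\mathrm{Inv}(w)}\mathbf{1}_{I\supseteq\{a,a+1,\dots,b-1\}}\qquad\text{for all } I\subseteq[n].\]
   Context: $S_n$ is the symmetric group on $[n]$; $\mathrm{Inv}(w)$ is the set of pairs $(a,b)$, $a<b$, with $w(a)>w(b)$, and $\ell(w)=|\mathrm{Inv}(w)|$. For $a<b$, $wt_{ab}$ swaps entries in positions $a,b$. Bruhat covers: $u\lessdot v$ iff $v=ut_{ab}$ ($a<b$) and $\ell(v)=\ell(u)+1$. Edge weight $m(u\lessdot ut_{ab})=x_a+\dots+x_{b-1}$; a saturated chain $C=(u_0\lessdot\cdots\lessdot u_\ell)$ has weight $m_C=\prod_i m(u_{i-1}\lessdot u_i)$. The dual Schubert polynomial is $D^w=\frac{1}{\ell(w)!}\sum_C m_C$ over saturated chains $C$ from $\mathrm{id}$ to $w$. The Newton polytope of a polynomial is the convex hull of its exponent vectors with nonzero coefficient. For real numbers $\{z_I\}_{I\subseteq[n]}$, the generalized permutahedron is $P_n^z(\{z_I\})=\{t\in\mathbb{R}^n: \sum_{i\in I}t_i\ge z_I \text{ for all } I\ne[n],\ \sum_{i=1}^n t_i=z_{[n]}\}$. $\mathbf{1}$ denotes the indicator (1 if the condition holds, 0 otherwise). *)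

theory Defs
  imports "HOL-Analysis.Analysis" "HOL-Combinatorics.Permutations" "HOL-Library.Poly_Mapping"
begin

text \<open>
  The index set \<open>[n]\<close> is a finite linearly ordered type \<open>'n\<close> with \<open>CARD('n) = n\<close>, so that
  \<open>\<real>\<^sup>n\<close> is \<open>real ^ 'n\<close>, elements of \<open>S\<^sub>n\<close> are the functions \<open>w\<close> with \<open>w permutes UNIV\<close>, and
  \<open>{a, a+1, \<dots>, b-1}\<close> is \<open>{a..<b}\<close>. Polynomials in the variables \<open>x\<^sub>i\<close> (\<open>i :: 'n\<close>) over \<open>'k\<close> are
  elements of the monoid algebra \<open>('n \<Rightarrow>\<^sub>0 nat) \<Rightarrow>\<^sub>0 'k\<close>: finitely supported maps from exponent
  vectors to coefficients.
\<close>

definition inversions :: "('n::{finite,linorder} \<Rightarrow> 'n) \<Rightarrow> ('n \<times> 'n) set" where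
  "inversions w = {(a, b). a < b \<and> w a > w b}"

definition perm_length :: "('n::{finite,linorder} \<Rightarrow> 'n) \<Rightarrow> nat" where
  "perm_length w = card (inversions w)"

definition bruhat_cover ::
  "('n::{finite,linorder} \<Rightarrow> 'n) \<Rightarrow> ('n \<Rightarrow> 'n) \<Rightarrow> bool" where
  "bruhat_cover u v \<longleftrightarrow>
     (\<exists>a b. a < b \<and> v = u \<circ> Transposition.transpose a b) \<and> perm_length v = perm_length u + 1"

definition pvar :: "'n \<Rightarrow> ('n \<Rightarrow>\<^sub>0 nat) \<Rightarrow>\<^sub>0 rat" where
  "pvar i = Poly_Mapping.single (Poly_Mapping.single i 1) 1"

text \<open>
  The pair \<open>a < b\<close> with \<open>v = u t\<^sub>a\<^sub>b\<close> is determined by \<open>u\<close> and \<open>v\<close>; see \<open>edge_weight_transpose\<close> below.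
\<close>

definition edge_weight ::
  "('n::{finite,linorder} \<Rightarrow> 'n) \<Rightarrow> ('n \<Rightarrow> 'n) \<Rightarrow> ('n \<Rightarrow>\<^sub>0 nat) \<Rightarrow>\<^sub>0 rat" where
  "edge_weight u v =
     (case (THE (a, b). a < b \<and> v = u \<circ> Transposition.transpose a b) of
        (a, b) \<Rightarrow> \<Sum>c\<in>{a..<b}. pvar c)"

definition saturated_chains ::
  "('n::{finite,linorder} \<Rightarrow> 'n) \<Rightarrow> ('n \<Rightarrow> 'n) \<Rightarrow> ('n \<Rightarrow> 'n) list set" where
  "saturated_chains u w = {C. C \<noteq> [] \<and> hd C = u \<and> last C = w \<and> successively bruhat_cover C}"

definition chain_weight :: "('n::{finite,linorder} \<Rightarrow> 'n) list \<Rightarrow> ('n \<Rightarrow>\<^sub>0 nat) \<Rightarrow>\<^sub>0 rat" where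
  "chain_weight C = prod_list (map2 edge_weight C (tl C))"

definition dual_schubert :: "('n::{finite,linorder} \<Rightarrow> 'n) \<Rightarrow> ('n \<Rightarrow>\<^sub>0 nat) \<Rightarrow>\<^sub>0 rat" where
  "dual_schubert w =
     Poly_Mapping.single 0 (1 / fact (perm_length w)) * (\<Sum>C\<in>saturated_chains id w. chain_weight C)"

definition newton_polytope :: "(('n::finite \<Rightarrow>\<^sub>0 nat) \<Rightarrow>\<^sub>0 'k::zero) \<Rightarrow> (real ^ 'n) set" where
  "newton_polytope f =
     convex hull ((\<lambda>e. \<chi> i. real (Poly_Mapping.lookup e i)) ` Poly_Mapping.keys f)"

definition generalized_permutahedron :: "('n::finite set \<Rightarrow> real) \<Rightarrow> (real ^ 'n) set" where
  "generalized_permutahedron z =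
     {t. (\<forall>I. I \<noteq> UNIV \<longrightarrow> (\<Sum>i\<in>I. t $ i) \<ge> z I) \<and> (\<Sum>i\<in>UNIV. t $ i) = z UNIV}"

lemma edge_weight_transpose:
  fixes u :: "'n::{finite,linorder} \<Rightarrow> 'n"
  assumes "u permutes UNIV" and "a < b"
  shows "edge_weight u (u \<circ> Transposition.transpose a b) = (\<Sum>c\<in>{a..<b}. pvar c)"
proof -
  have inj: "inj u"
    using assms(1) by (rule permutes_inj)
  have "c = a \<and> d = b"
    if "c < d" and eq: "u \<circ> Transposition.transpose a b = u \<circ> Transposition.transpose c d" for c d
  proof -
    have "Transposition.transpose a b x = Transposition.transpose c d x" for x
      using fun_cong[OF eq, of x] inj by (auto dest: injD)
    from this[of a] this[of b] this[of c] this[of d] show ?thesis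
      using \<open>a < b\<close> \<open>c < d\<close> by (auto simp: Transposition.transpose_def split: if_splits)
  qed
  then have "(THE (c, d). c < d \<and>
      u \<circ> Transposition.transpose a b = u \<circ> Transposition.transpose c d) = (a, b)"
    using \<open>a < b\<close> by (intro the_equality) auto
  then show ?thesis
    by (simp add: edge_weight_def)
qed

lemma length_saturated_chain:
  assumes "C \<in> saturated_chains u w"
  shows "perm_length w + 1 = perm_length u + length C"
proof -
  have "perm_length (last C) + 1 = perm_length (hd C) + length C"
    if "C \<noteq> []" "successively bruhat_cover C"
    using that
    by (induction C rule: induct_list012) (auto simp: bruhat_cover_def)
  then show ?thesis
    using assms by (auto simp: saturated_chains_def)
qed

lemma finite_saturated_chains: "finite (saturated_chains u w)"
proof (rule finite_subset)
  show "saturated_chains u w \<subseteq> {C. set C \<subseteq> UNIV \<and> length C \<le> perm_length w + 1}"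
    using length_saturated_chain by fastforce
  show "finite {C :: ('a \<Rightarrow> 'a) list. set C \<subseteq> UNIV \<and> length C \<le> perm_length w + 1}"
    by (intro finite_lists_length_le) simp
qed

end

theory Submission imports Defs begin

text \<open>
  All coefficients are nonnegative, so the exponents of \<open>D\<^sup>w\<close> are those of the weights of the single
  chains. Along a cover \<open>u \<lessdot> u t\<^sub>a\<^sub>b\<close> the number of inversions \<open>(c, d)\<close> with \<open>{c..<d} \<subseteq> I\<close> grows by
  at most one, and only if \<open>{a..<b} \<subseteq> I\<close>; this gives the inequalities. Conversely, multiplying on
  the left by a simple transposition (exchanging adjacent values) changes the inversion set by a
  single pair, so a chain in the left weak order has the inversions of \<open>w\<close> as its labels, and its
  exponents minimise any linear functional \<open>y\<close> with value \<open>\<Sum>\<^bsub>(a,b)\<^esub> min\<^bsub>{a..<b}\<^esub> y\<close>. Decomposing \<open>y\<close>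
  into indicators of superlevel sets shows that \<open>y\<close> is nowhere smaller on the generalized
  permutahedron, so no point of it can be separated from the Newton polytope.
\<close>

section \<open>Polynomials with nonnegative coefficients\<close>

definition nonneg_coeffs :: "('a \<Rightarrow>\<^sub>0 'b::{zero,ord}) \<Rightarrow> bool" where
  "nonneg_coeffs p \<longleftrightarrow> (\<forall>e. Poly_Mapping.lookup p e \<ge> 0)"

lemma nonneg_coeffs_single:
  "c \<ge> (0::'b::linordered_semidom) \<Longrightarrow> nonneg_coeffs (Poly_Mapping.single e c)"
  by (simp add: nonneg_coeffs_def lookup_single when_def)

lemma nonneg_coeffs_add:
  fixes p q :: "'a \<Rightarrow>\<^sub>0 'b::linordered_semidom"
  shows "nonneg_coeffs p \<Longrightarrow> nonneg_coeffs q \<Longrightarrow> nonneg_coeffs (p + q)"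
  by (simp add: nonneg_coeffs_def lookup_add)

lemma nonneg_coeffs_sum:
  fixes f :: "'i \<Rightarrow> 'a \<Rightarrow>\<^sub>0 'b::linordered_semidom"
  shows "(\<And>i. i \<in> A \<Longrightarrow> nonneg_coeffs (f i)) \<Longrightarrow> nonneg_coeffs (sum f A)"
  by (simp add: nonneg_coeffs_def lookup_sum sum_nonneg)

lemma Sum_any_nonneg:
  fixes f :: "'a \<Rightarrow> 'b::linordered_semidom"
  assumes "\<And>a. f a \<ge> 0"
  shows "Sum_any f \<ge> 0"
  unfolding Sum_any.expand_set by (intro sum_nonneg assms)

lemma nonneg_coeffs_mult:
  fixes p q :: "'a::monoid_add \<Rightarrow>\<^sub>0 'b::linordered_semidom"
  assumes "nonneg_coeffs p" "nonneg_coeffs q"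
  shows "nonneg_coeffs (p * q)"
  using assms unfolding nonneg_coeffs_def lookup_mult
  by (auto intro!: Sum_any_nonneg mult_nonneg_nonneg simp: when_def)

lemma keys_add_nonneg:
  fixes p q :: "'a \<Rightarrow>\<^sub>0 'b::linordered_semidom"
  assumes "nonneg_coeffs p" "nonneg_coeffs q"
  shows "Poly_Mapping.keys (p + q) = Poly_Mapping.keys p \<union> Poly_Mapping.keys q"
  using assms by (auto simp: nonneg_coeffs_def in_keys_iff lookup_add add_nonneg_eq_0_iff)

lemma keys_sum_nonneg:
  fixes f :: "'i \<Rightarrow> 'a \<Rightarrow>\<^sub>0 'b::linordered_semidom"
  assumes "finite A" "\<And>i. i \<in> A \<Longrightarrow> nonneg_coeffs (f i)"
  shows "Poly_Mapping.keys (sum f A) = (\<Union>i\<in>A. Poly_Mapping.keys (f i))"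
  using assms
  by (induction A rule: finite_induct) (auto simp: keys_add_nonneg nonneg_coeffs_sum)

text \<open>Nothing cancels: the terms at \<open>a\<close> and \<open>b\<close> alone give a
  positive coefficient at \<open>a + b\<close>, and all other contributions are nonnegative.\<close>

lemma keys_mult_nonneg:
  fixes p q :: "'a::monoid_add \<Rightarrow>\<^sub>0 'b::linordered_idom"
  assumes "nonneg_coeffs p" "nonneg_coeffs q"
  shows "Poly_Mapping.keys (p * q) = {a + b | a b. a \<in> Poly_Mapping.keys p \<and> b \<in> Poly_Mapping.keys q}"
proof
  show "Poly_Mapping.keys (p * q) \<subseteq> {a + b | a b. a \<in> Poly_Mapping.keys p \<and> b \<in> Poly_Mapping.keys q}"
    by (rule keys_mult)
next
  have "a + b \<in> Poly_Mapping.keys (p * q)"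
    if a: "a \<in> Poly_Mapping.keys p" and b: "b \<in> Poly_Mapping.keys q" for a b
  proof -
    let ?s = "\<lambda>r e. Poly_Mapping.single e (Poly_Mapping.lookup r e)"
    have nn: "nonneg_coeffs (?s r e)" "nonneg_coeffs (r - ?s r e)"
      if "nonneg_coeffs r" for r :: "'a \<Rightarrow>\<^sub>0 'b" and e
      using that by (auto simp: nonneg_coeffs_def lookup_single lookup_minus when_def)
    have split: "p * q = ?s p a * ?s q b + (?s p a * (q - ?s q b) + (p - ?s p a) * q)"
      by (simp add: algebra_simps)
    have "Poly_Mapping.keys (?s p a * ?s q b) \<subseteq> Poly_Mapping.keys (p * q)"
      by (subst split, subst keys_add_nonneg)
        (auto intro!: nonneg_coeffs_mult nonneg_coeffs_add nn assms)
    moreover have "a + b \<in> Poly_Mapping.keys (?s p a * ?s q b)"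
      using a b by (simp add: mult_single in_keys_iff)
    ultimately show ?thesis by blast
  qed
  then show "{a + b | a b. a \<in> Poly_Mapping.keys p \<and> b \<in> Poly_Mapping.keys q} \<subseteq> Poly_Mapping.keys (p * q)"
    by blast
qed

lemma nonneg_coeffs_pvar: "nonneg_coeffs (pvar i)"
  by (simp add: pvar_def nonneg_coeffs_single)

lemma nonneg_coeffs_edge_weight: "nonneg_coeffs (edge_weight u v)"
  unfolding edge_weight_def
  by (auto split: prod.splits intro!: nonneg_coeffs_sum nonneg_coeffs_pvar)

lemma nonneg_coeffs_prod_list:
  fixes ps :: "('a::monoid_add \<Rightarrow>\<^sub>0 'b::linordered_semidom) list"
  shows "(\<And>p. p \<in> set ps \<Longrightarrow> nonneg_coeffs p) \<Longrightarrow> nonneg_coeffs (prod_list ps)"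
  by (induction ps) (auto simp: nonneg_coeffs_mult nonneg_coeffs_single simp flip: single_one)

lemma nonneg_coeffs_chain_weight: "nonneg_coeffs (chain_weight C)"
  unfolding chain_weight_def
  by (rule nonneg_coeffs_prod_list) (auto simp: nonneg_coeffs_edge_weight)

lemma keys_edge_weight_transpose:
  fixes u :: "'n::{finite,linorder} \<Rightarrow> 'n"
  assumes "u permutes UNIV" "a < b"
  shows "Poly_Mapping.keys (edge_weight u (u \<circ> Transposition.transpose a b)) =
    (\<lambda>c. Poly_Mapping.single c 1) ` {a..<b}"
  unfolding edge_weight_transpose[OF assms]
  by (subst keys_sum_nonneg) (auto simp: nonneg_coeffs_pvar, auto simp: pvar_def)

lemma keys_dual_schubert:
  "Poly_Mapping.keys (dual_schubert w) =
    (\<Union>C\<in>saturated_chains id w. Poly_Mapping.keys (chain_weight C))"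
  unfolding dual_schubert_def
  by (subst keys_mult_nonneg)
    (auto simp: nonneg_coeffs_single nonneg_coeffs_sum nonneg_coeffs_chain_weight
      keys_sum_nonneg finite_saturated_chains)

section \<open>Inversions and Bruhat covers\<close>

text \<open>
  Sorting the transposed pair is an involution of the increasing pairs; it matches the inversions of
  \<open>u\<close> with those of \<open>u t\<^sub>a\<^sub>b\<close> up to the pairs \<open>(a, b)\<close>, \<open>(a, d)\<close>, \<open>(d, b)\<close> with
  \<open>a < d < b\<close>.
\<close>

definition swap_pair :: "'n::linorder \<Rightarrow> 'n \<Rightarrow> 'n \<times> 'n \<Rightarrow> 'n \<times> 'n" where
  "swap_pair a b = (\<lambda>(c, d). let c' = Transposition.transpose a b c; d' = Transposition.transpose a b d
    in if c' < d' then (c', d') else (c, d))"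

lemma swap_pair_swap_pair: "fst p < snd p \<Longrightarrow> swap_pair a b (swap_pair a b p) = p"
  by (cases p) (auto simp: swap_pair_def Let_def)

lemma inj_on_swap_pair: "inj_on (swap_pair a b) {(c, d). c < d}"
  by (rule inj_on_inverseI[where g = "swap_pair a b"]) (auto simp: swap_pair_swap_pair)

text \<open>If the transposed positions stay in order, the pair carries its values along. Otherwise
  it starts at \<open>a\<close> or ends at \<open>b\<close> inside the interval, and putting
  \<open>u b\<close> at \<open>a\<close> or \<open>u a\<close> at \<open>b\<close> keeps it an
  inversion.\<close>

lemma swap_pair_inversions:
  assumes "u a < u b" "a < b"
  shows "swap_pair a b ` inversions u \<subseteq> inversions (u \<circ> Transposition.transpose a b)"
  using assms
  by (auto simp: swap_pair_def Let_def inversions_def Transposition.transpose_def split: if_splits)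

text \<open>\<open>swap_pair\<close> embeds the inversions of \<open>u\<close> into the new ones and
  misses \<open>(a, b)\<close>; an intermediate value at position \<open>d\<close> makes it miss
  \<open>(a, d)\<close> as well.\<close>

lemma perm_length_transpose_less:
  fixes u :: "'n::{finite,linorder} \<Rightarrow> 'n"
  assumes "u a < u b" "a < b"
  shows "perm_length u < perm_length (u \<circ> Transposition.transpose a b)"
    and "\<lbrakk>a < d; d < b; u a < u d; u d < u b\<rbrakk>
      \<Longrightarrow> perm_length u + 1 < perm_length (u \<circ> Transposition.transpose a b)"
proof -
  let ?v = "u \<circ> Transposition.transpose a b"
  let ?im = "swap_pair a b ` inversions u"
  have sub: "?im \<subseteq> inversions ?v"
    using swap_pair_inversions[of u a b] assms by simp
  have card: "card ?im = perm_length u"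
    unfolding perm_length_def
    by (rule card_image, rule inj_on_subset[OF inj_on_swap_pair]) (auto simp: inversions_def)
  \<comment> \<open>The range of \<open>d\<close> includes \<open>b\<close>, so both missed pairs
    are covered. The involution fixes \<open>(a, d)\<close>, whose only possible preimage is thus
    itself, no inversion of \<open>u\<close>.\<close>
  have notin: "(a, d) \<notin> ?im" if d: "a < d" "d \<le> b" "u a < u d" for d
  proof
    assume "(a, d) \<in> ?im"
    then obtain p where p: "p \<in> inversions u" "(a, d) = swap_pair a b p" by blast
    then have "p = swap_pair a b (a, d)"
      by (auto simp: swap_pair_swap_pair inversions_def)
    also have "\<dots> = (a, d)"
      using d assms(2) by (cases "d = b") (auto simp: swap_pair_def Let_def)
    finally show False
      using p(1) d(3) by (auto simp: inversions_def dest: less_asym)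
  qed
  have ab: "(a, b) \<notin> ?im" "(a, b) \<in> inversions ?v"
    using assms notin[of b] by (simp_all add: inversions_def)
  then have "?im \<subset> inversions ?v"
    using sub by blast
  then show "perm_length u < perm_length ?v"
    using psubset_card_mono[of "inversions ?v" ?im] by (simp add: card perm_length_def[of ?v])
  show "perm_length u + 1 < perm_length ?v" if d: "a < d" "d < b" "u a < u d" "u d < u b"
  proof -
    have "(a, d) \<notin> ?im" "(a, d) \<in> inversions ?v"
      using assms d notin[of d] by (simp_all add: inversions_def)
    moreover have "(a, d) \<notin> insert (a, b) ?im"
      using calculation d(2) by simp
    ultimately have "insert (a, b) ?im \<subset> inversions ?v"
      using sub ab(2) by (metis insert_subset psubsetI)
    then have "card (insert (a, b) ?im) < perm_length ?v"
      unfolding perm_length_def by (intro psubset_card_mono) auto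
    then show ?thesis
      using ab by (simp add: card)
  qed
qed

text \<open>The length condition becomes local: \<open>u a > u b\<close> would lower the length, and
  an intermediate value at an intermediate position would raise it by more than one.\<close>

lemma bruhat_coverE:
  fixes u :: "'n::{finite,linorder} \<Rightarrow> 'n"
  assumes "bruhat_cover u v" "u permutes UNIV"
  obtains a b where "a < b" "v = u \<circ> Transposition.transpose a b" "u a < u b"
    "\<And>d. a < d \<Longrightarrow> d < b \<Longrightarrow> u d < u a \<or> u b < u d"
proof -
  obtain a b where ab: "a < b" and v: "v = u \<circ> Transposition.transpose a b"
    and len: "perm_length v = perm_length u + 1"
    using assms(1) by (auto simp: bruhat_cover_def)
  have inj: "inj u"
    using assms(2) by (rule permutes_inj)
  have u_v: "u = v \<circ> Transposition.transpose a b"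
    by (simp add: v comp_assoc)
  have "\<not> v a < v b"
    using perm_length_transpose_less(1)[of v a b] ab len u_v by auto
  then have less: "u a < u b"
    using ab injD[OF inj, of a b] by (metis v comp_apply less_irrefl linorder_neqE
        transpose_apply_first transpose_apply_second)
  have "u d < u a \<or> u b < u d" if "a < d" "d < b" for d
  proof -
    have "\<not> (u a < u d \<and> u d < u b)"
      using perm_length_transpose_less(2)[OF less ab that] len v by auto
    moreover have "u d \<noteq> u a" "u d \<noteq> u b"
      using that injD[OF inj] by blast+
    ultimately show ?thesis by auto
  qed
  then show thesis
    using that ab v less by blast
qed

lemma bruhat_cover_permutes:
  "bruhat_cover u v \<Longrightarrow> u permutes UNIV \<Longrightarrow> v permutes UNIV"
  by (auto simp: bruhat_cover_def intro: permutes_compose permutes_swap_id)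

text \<open>The cardinality of this set is the number \<open>z_I\<close> of the theorem.\<close>

definition inversions_in :: "'n set \<Rightarrow> ('n::{finite,linorder} \<Rightarrow> 'n) \<Rightarrow> ('n \<times> 'n) set" where
  "inversions_in I w = {(a, b) \<in> inversions w. {a..<b} \<subseteq> I}"

text \<open>If \<open>{a..<b}\<close> lies in \<open>I\<close>, then \<open>swap_pair\<close> sends
  every new inversion except \<open>(a, b)\<close> injectively to an old one, without leaving
  \<open>I\<close>. If not, no interval inside \<open>I\<close> contains \<open>{a..<b}\<close>, and
  \<open>mid\<close> shows that every new inversion is an old one.\<close>

lemma card_inversions_in_cover:
  fixes u :: "'n::{finite,linorder} \<Rightarrow> 'n"
  assumes "u permutes UNIV" and ab: "a < b" "u a < u b"
    and mid: "\<And>d. a < d \<Longrightarrow> d < b \<Longrightarrow> u d < u a \<or> u b < u d"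
  shows "card (inversions_in I (u \<circ> Transposition.transpose a b)) \<le>
    card (inversions_in I u) + of_bool ({a..<b} \<subseteq> I)"
proof (cases "{a..<b} \<subseteq> I")
  case True
  let ?v = "u \<circ> Transposition.transpose a b"
  have "swap_pair a b p \<in> inversions_in I u" if p: "p \<in> inversions_in I ?v - {(a, b)}" for p
  proof -
    obtain c d where cd: "p = (c, d)" "c < d" "?v c > ?v d" "{c..<d} \<subseteq> I" "(c, d) \<noteq> (a, b)"
      using p by (auto simp: inversions_in_def inversions_def)
    let ?c = "Transposition.transpose a b c" and ?d = "Transposition.transpose a b d"
    show ?thesis
    proof (cases "?c < ?d")
      case less: True
      have "{?c..<?d} \<subseteq> {c..<d} \<union> {a..<b}"
        using less cd(2,5) ab(1) by (auto simp: Transposition.transpose_def split: if_splits)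
      then show ?thesis
        using less cd True by (auto simp: swap_pair_def inversions_in_def inversions_def)
    next
      case False
      \<comment> \<open>The order is reversed only for a pair inside the interval that shares
        exactly one end with \<open>(a, b)\<close>; \<open>mid\<close> settles the comparison at its
        other end.\<close>
      then have "(c = a \<and> d < b) \<or> (a < c \<and> d = b)"
        using cd(2,5) ab(1) by (auto simp: Transposition.transpose_def split: if_splits)
      then have "u d < u c"
      proof
        assume "c = a \<and> d < b"
        then show ?thesis
          using mid[of d] cd(2,3) ab(1) by (auto simp: Transposition.transpose_def split: if_splits)
      next
        assume "a < c \<and> d = b"
        then show ?thesis
          using mid[of c] cd(2,3) ab(1) by (auto simp: Transposition.transpose_def split: if_splits)
      qed
      then show ?thesis
        using False cd by (auto simp: swap_pair_def inversions_in_def inversions_def)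
    qed
  qed
  then have "swap_pair a b ` (inversions_in I ?v - {(a, b)}) \<subseteq> inversions_in I u"
    by blast
  moreover have "inj_on (swap_pair a b) (inversions_in I ?v - {(a, b)})"
    by (rule inj_on_subset[OF inj_on_swap_pair]) (auto simp: inversions_in_def inversions_def)
  ultimately have "card (inversions_in I ?v - {(a, b)}) \<le> card (inversions_in I u)"
    by (intro card_inj_on_le) auto
  then show ?thesis
    using True card_Diff1_le[of "inversions_in I ?v" "(a, b)"]
    by (cases "(a, b) \<in> inversions_in I ?v") (auto simp: card_Diff_singleton)
next
  case False
  have "inversions_in I (u \<circ> Transposition.transpose a b) \<subseteq> inversions_in I u"
  proof (clarsimp simp: inversions_in_def inversions_def)
    fix c d
    assume cd: "c < d" "u (Transposition.transpose a b d) < u (Transposition.transpose a b c)"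
      "{c..<d} \<subseteq> I"
    have "\<not> (c \<le> a \<and> b \<le> d)"
    proof
      assume "c \<le> a \<and> b \<le> d"
      then have "{a..<b} \<subseteq> {c..<d}" by auto
      with cd(3) False show False by blast
    qed
    then show "u d < u c"
      using cd(1,2) ab mid[of c] mid[of d]
      by (auto simp: Transposition.transpose_def not_le split: if_splits dest: less_trans)
  qed
  then show ?thesis
    by (simp add: False card_mono)
qed

text \<open>Each edge contributes one variable with index in \<open>{a..<b}\<close>. If
  \<open>{a..<b}\<close> lies in \<open>I\<close>, the degree in the variables of \<open>I\<close>
  grows, and only then can the inversions inside \<open>I\<close> become more numerous.\<close>

lemma chain_exponent_bounds:
  fixes C :: "('n::{finite,linorder} \<Rightarrow> 'n) list"
  assumes "successively bruhat_cover C" "C \<noteq> []" "hd C permutes UNIV"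
    and "e \<in> Poly_Mapping.keys (chain_weight C)"
  shows "card (inversions_in I (last C)) \<le>
      card (inversions_in I (hd C)) + (\<Sum>i\<in>I. Poly_Mapping.lookup e i)"
    and "perm_length (last C) = perm_length (hd C) + (\<Sum>i\<in>UNIV. Poly_Mapping.lookup e i)"
proof -
  have "card (inversions_in I (last C)) \<le>
      card (inversions_in I (hd C)) + (\<Sum>i\<in>I. Poly_Mapping.lookup e i) \<and>
    perm_length (last C) = perm_length (hd C) + (\<Sum>i\<in>UNIV. Poly_Mapping.lookup e i)"
    using assms
  proof (induction C arbitrary: e rule: induct_list012)
    case 1
    then show ?case by simp
  next
    case (2 u)
    then have "e = 0"
      by (simp add: chain_weight_def)
    then show ?case by simp
  next
    case (3 u v C)
    have cover: "bruhat_cover u v" and u: "u permutes UNIV"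
      using "3.prems" by auto
    obtain a b where ab: "a < b" "v = u \<circ> Transposition.transpose a b" "u a < u b"
      "\<And>d. a < d \<Longrightarrow> d < b \<Longrightarrow> u d < u a \<or> u b < u d"
      using bruhat_coverE[OF cover u] by blast
    have "chain_weight (u # v # C) = edge_weight u v * chain_weight (v # C)"
      by (simp add: chain_weight_def)
    then obtain c e' where c: "c \<in> {a..<b}" and e: "e = Poly_Mapping.single c 1 + e'"
      and e': "e' \<in> Poly_Mapping.keys (chain_weight (v # C))"
      using "3.prems"(4) ab(2)
      by (auto simp: keys_mult_nonneg nonneg_coeffs_edge_weight nonneg_coeffs_chain_weight
          keys_edge_weight_transpose[OF u ab(1)])
    have IH: "card (inversions_in I (last (v # C))) \<le>
          card (inversions_in I v) + (\<Sum>i\<in>I. Poly_Mapping.lookup e' i)"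
        "perm_length (last (v # C)) = perm_length v + (\<Sum>i\<in>UNIV. Poly_Mapping.lookup e' i)"
      using "3.IH"(2)[OF _ _ _ e'] "3.prems" bruhat_cover_permutes[OF cover u] by auto
    have lookup_e: "(\<Sum>i\<in>J. Poly_Mapping.lookup e i) =
        of_bool (c \<in> J) + (\<Sum>i\<in>J. Poly_Mapping.lookup e' i)" for J
      by (simp add: e lookup_add sum.distrib lookup_single when_def)
    have "card (inversions_in I v) \<le> card (inversions_in I u) + of_bool ({a..<b} \<subseteq> I)"
      using card_inversions_in_cover[OF u ab(1,3)] ab(2,4) by blast
    also have "\<dots> \<le> card (inversions_in I u) + of_bool (c \<in> I)"
      using c by auto
    finally show ?case
      using IH cover by (simp add: lookup_e bruhat_cover_def)
  qed
  then show "card (inversions_in I (last C)) \<le>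
      card (inversions_in I (hd C)) + (\<Sum>i\<in>I. Poly_Mapping.lookup e i)"
    "perm_length (last C) = perm_length (hd C) + (\<Sum>i\<in>UNIV. Poly_Mapping.lookup e i)"
    by auto
qed

section \<open>A chain labelled by the inversions\<close>

text \<open>Such a \<open>w\<close> is strictly increasing. By induction on the number of elements
  below \<open>x\<close>, the value \<open>x\<close> is taken neither before nor after position
  \<open>x\<close>.\<close>

lemma no_inversions_imp_id:
  fixes w :: "'n::{finite,linorder} \<Rightarrow> 'n"
  assumes "w permutes UNIV" "inversions w = {}"
  shows "w = id"
proof -
  have inj: "inj w"
    using assms(1) by (rule permutes_inj)
  have mono: "w a < w b" if "a < b" for a b
  proof -
    have "\<not> w b < w a" "w a \<noteq> w b"
      using assms(2) injD[OF inj, of a b] that by (auto simp: inversions_def)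
    then show ?thesis by simp
  qed
  have less: "w a < w b \<longleftrightarrow> a < b" for a b
    using mono by (metis less_asym linorder_neqE)
  have "w x = x" for x
  proof (induction "card {..<x}" arbitrary: x rule: less_induct)
    case less': less
    have IH: "w y = y" if "y < x" for y
      using that by (intro less') (auto intro!: psubset_card_mono)
    obtain z where z: "w z = x"
      using permutes_surj[OF assms(1)] by (metis surjD)
    have "\<not> z < x"
      using IH[of z] z by auto
    moreover have "\<not> w x < x"
      using IH[of "w x"] injD[OF inj, of "w x" x] by auto
    ultimately show ?case
      using z less[of x z] by (metis linorder_neqE)
  qed
  then show ?thesis by auto
qed

text \<open>Take an inversion with the fewest values strictly between. The position of such a value
  would form an inversion of smaller gap with \<open>a\<close> or \<open>b\<close>.\<close>

lemma inversion_adjacent_values: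
  fixes w :: "'n::{finite,linorder} \<Rightarrow> 'n"
  assumes "w permutes UNIV" "inversions w \<noteq> {}"
  obtains a b where "(a, b) \<in> inversions w" "{w b<..<w a} = {}"
proof -
  obtain p where p: "p \<in> inversions w"
    and min: "\<And>q. q \<in> inversions w \<Longrightarrow> card {w (snd p)<..<w (fst p)} \<le> card {w (snd q)<..<w (fst q)}"
    using ex_has_least_nat[of "\<lambda>p. p \<in> inversions w" _ "\<lambda>p. card {w (snd p)<..<w (fst p)}"] assms(2)
    by blast
  obtain a b where ab: "p = (a, b)" "a < b" "w b < w a"
    using p by (auto simp: inversions_def)
  have False if v: "v \<in> {w b<..<w a}" for v
  proof -
    obtain c where c: "w c = v"
      using permutes_surj[OF assms(1)] by (metis surjD)
    have lt: "card {w b<..<v} < card {w b<..<w a}" "card {v<..<w a} < card {w b<..<w a}"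
      using v by (auto intro!: psubset_card_mono)
    show False
    proof (cases "c < b")
      case True
      then show False
        using min[of "(c, b)"] v c ab lt by (auto simp: inversions_def)
    next
      case False
      then have "a < c"
        using ab(2) by simp
      then show False
        using min[of "(a, c)"] v c ab lt by (auto simp: inversions_def)
    qed
  qed
  then show thesis
    using that[of a b] p ab(1) by blast
qed

text \<open>Every other value compares alike with \<open>w a\<close> and \<open>w b\<close>, so
  exchanging these two affects only the pair \<open>(a, b)\<close>.\<close>

lemma inversions_transpose_adjacent_values:
  fixes w :: "'n::{finite,linorder} \<Rightarrow> 'n"
  assumes "w permutes UNIV" "(a, b) \<in> inversions w" "{w b<..<w a} = {}"
  shows "inversions (w \<circ> Transposition.transpose a b) = inversions w - {(a, b)}"
proof -
  have ab: "a < b" "w b < w a"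
    using assms(2) by (auto simp: inversions_def)
  have inj: "w x = w y \<longleftrightarrow> x = y" for x y
    using permutes_inj[OF assms(1)] by (auto dest: injD)
  have adj: "w x < w b \<longleftrightarrow> w x < w a" "w b < w x \<longleftrightarrow> w a < w x" if "x \<noteq> a" "x \<noteq> b" for x
  proof -
    have "\<not> (w b < w x \<and> w x < w a)" "w x \<noteq> w a" "w x \<noteq> w b"
      using assms(3) that inj by auto
    with ab(2) show "w x < w b \<longleftrightarrow> w x < w a" "w b < w x \<longleftrightarrow> w a < w x"
      by (auto dest: less_trans)
  qed
  show ?thesis
    using ab adj by (auto simp: inversions_def Transposition.transpose_def split: if_splits)
qed

text \<open>Induction on the length: an inversion with adjacent values labels the last edge, the
  other inversions label the rest. From each edge the variable \<open>c p\<close> is then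
  selected.\<close>

lemma weak_order_chain:
  fixes w :: "'n::{finite,linorder} \<Rightarrow> 'n"
  assumes "w permutes UNIV" "\<And>a b. (a, b) \<in> inversions w \<Longrightarrow> c (a, b) \<in> {a..<b}"
  obtains C where "C \<in> saturated_chains id w"
    "(\<Sum>p\<in>inversions w. Poly_Mapping.single (c p) 1) \<in> Poly_Mapping.keys (chain_weight C)"
proof -
  have "\<exists>C\<in>saturated_chains id w.
      (\<Sum>p\<in>inversions w. Poly_Mapping.single (c p) 1) \<in> Poly_Mapping.keys (chain_weight C)"
    using assms
  proof (induction "perm_length w" arbitrary: w rule: less_induct)
    case less
    show ?case
    proof (cases "inversions w = {}")
      case True
      then have "w = id"
        using no_inversions_imp_id less.prems(1) by blast
      then show ?thesis
        by (intro bexI[of _ "[id]"])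
          (use True in \<open>auto simp: saturated_chains_def chain_weight_def\<close>)
    next
      case False
      then obtain a b where ab: "(a, b) \<in> inversions w" "{w b<..<w a} = {}"
        using inversion_adjacent_values less.prems(1) by blast
      define u where "u = w \<circ> Transposition.transpose a b"
      have u: "u permutes UNIV"
        unfolding u_def by (intro permutes_compose[OF _ less.prems(1)] permutes_swap_id) auto
      have w: "w = u \<circ> Transposition.transpose a b"
        by (simp add: u_def comp_assoc)
      have lt: "a < b"
        using ab(1) by (simp add: inversions_def)
      have inv: "inversions u = inversions w - {(a, b)}"
        unfolding u_def using inversions_transpose_adjacent_values less.prems(1) ab .
      have len: "perm_length w = perm_length u + 1"
        unfolding perm_length_def inv using card.remove[OF _ ab(1)] by simp
      obtain C where C: "C \<in> saturated_chains id u"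
        and e: "(\<Sum>p\<in>inversions u. Poly_Mapping.single (c p) 1) \<in> Poly_Mapping.keys (chain_weight C)"
        using less.hyps[of u] u len less.prems(2) inv by auto
      have "bruhat_cover u w"
        using lt w len by (auto simp: bruhat_cover_def)
      then have "C @ [w] \<in> saturated_chains id w"
        using C by (auto simp: saturated_chains_def successively_append_iff)
      moreover have "chain_weight (C @ [w]) = chain_weight C * edge_weight u w"
      proof -
        \<comment> \<open>The chain grows at its end, while \<open>chain_weight\<close> unfolds from
          the front.\<close>
        have "chain_weight (C @ [w]) = chain_weight C * edge_weight (last C) w" if "C \<noteq> []"
          using that
          by (induction C rule: induct_list012) (auto simp: chain_weight_def mult.assoc)
        then show ?thesis
          using C by (simp add: saturated_chains_def)
      qed
      moreover have "Poly_Mapping.single (c (a, b)) 1 \<in> Poly_Mapping.keys (edge_weight u w)"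
        using less.prems(2)[OF ab(1)] keys_edge_weight_transpose[OF u lt] w by simp
      moreover have "(\<Sum>p\<in>inversions w. Poly_Mapping.single (c p) (1::nat)) =
          (\<Sum>p\<in>inversions u. Poly_Mapping.single (c p) 1) + Poly_Mapping.single (c (a, b)) 1"
        unfolding inv using sum.remove[OF _ ab(1)] by (simp add: add.commute)
      ultimately show ?thesis
        using e by (intro bexI[of _ "C @ [w]"])
          (auto simp: keys_mult_nonneg nonneg_coeffs_edge_weight nonneg_coeffs_chain_weight)
    qed
  qed
  then show thesis
    using that by blast
qed

section \<open>Linear functionals on generalized permutahedra\<close>

text \<open>
  Lowering \<open>y\<close> on the complement of its minimum level set until the next value is reached reduces
  the number of distinct values.
\<close>

lemma generalized_permutahedron_inner_ge:
  fixes t :: "real ^ 'n::finite" and y :: "'n \<Rightarrow> real"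
  assumes t: "t \<in> generalized_permutahedron (\<lambda>I. \<Sum>j\<in>J. of_bool (S j \<subseteq> I))"
    and c: "\<And>j i. j \<in> J \<Longrightarrow> i \<in> S j \<Longrightarrow> y (c j) \<le> y i"
  shows "(\<Sum>j\<in>J. y (c j)) \<le> (\<Sum>i\<in>UNIV. y i * t $ i)"
proof -
  have t_ge: "(\<Sum>j\<in>J. of_bool (S j \<subseteq> I)) \<le> (\<Sum>i\<in>I. t $ i)" if "I \<noteq> UNIV" for I
    using t that by (simp add: generalized_permutahedron_def)
  show ?thesis
    using c
  proof (induction "card {i. y i > Min (range y)}" arbitrary: y rule: less_induct)
    case less
    define m where "m = Min (range y)"
    let ?I = "{i. y i > m}"
    have m_le: "m \<le> y i" for i
      unfolding m_def by simp
    obtain i0 where i0: "y i0 = m"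
      unfolding m_def using Min_in[of "range y"] by fastforce
    show ?case
    proof (cases "?I = {}")
      case True
      then have "y i = m" for i
        using m_le[of i] by (auto simp: not_less intro: antisym)
      then have y: "y = (\<lambda>_. m)" by blast
      \<comment> \<open>For constant \<open>y\<close> the claim is an equality, by the condition on
        the total sum.\<close>
      have "(\<Sum>i\<in>UNIV. y i * t $ i) = m * (\<Sum>i\<in>UNIV. t $ i)"
        by (simp add: y sum_distrib_left)
      also have "\<dots> = (\<Sum>j\<in>J. y (c j))"
        using t by (simp add: y generalized_permutahedron_def)
      finally show ?thesis by simp
    next
      case False
      then obtain i1 where i1: "i1 \<in> ?I" and min_le: "\<And>i. i \<in> ?I \<Longrightarrow> y i1 \<le> y i"
        using arg_min_if_finite(1)[of ?I y] arg_min_least[of ?I _ y] by (metis finite)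
      \<comment> \<open>The gap between the minimum and the second smallest value of
        \<open>y\<close>, which is attained at \<open>i1\<close>.\<close>
      define \<delta> where "\<delta> = y i1 - m"
      define y' where "y' i = y i - \<delta> * of_bool (i \<in> ?I)" for i
      have \<delta>: "\<delta> > 0"
        using i1 by (simp add: \<delta>_def)
      have out: "y i = m" if "i \<notin> ?I" for i
        using antisym[OF m_le[of i]] that by simp
      have y'_ge: "m \<le> y' i" for i
        using min_le[of i] m_le[of i] by (auto simp: y'_def \<delta>_def)
      have "y' i0 = m"
        using i0 by (simp add: y'_def)
      then have m': "Min (range y') = m"
        using y'_ge by (intro Min_eqI) (auto intro: range_eqI[OF sym])
      \<comment> \<open>No index joins the set, and \<open>i1\<close> leaves it because its value
        drops to \<open>m\<close>.\<close>
      have "{i. y' i > Min (range y')} \<subset> ?I"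
      proof
        show "{i. y' i > Min (range y')} \<subseteq> ?I"
          unfolding m' using \<delta> by (auto simp: y'_def split: if_splits)
        show "{i. y' i > Min (range y')} \<noteq> ?I"
          unfolding m' using i1 by (auto simp: y'_def \<delta>_def set_eq_iff)
      qed
      then have "(\<Sum>j\<in>J. y' (c j)) \<le> (\<Sum>i\<in>UNIV. y' i * t $ i)"
      proof (intro less.hyps psubset_card_mono, fold m_def)
        fix j i assume ji: "j \<in> J" "i \<in> S j"
        \<comment> \<open>Values above \<open>m\<close> are lowered by the same amount and none
          falls below \<open>m\<close>, so the hypothesis on \<open>c\<close> persists.\<close>
        show "y' (c j) \<le> y' i"
        proof (cases "c j \<in> ?I")
          case True
          then have "i \<in> ?I"
            using less.prems[OF ji] by auto
          then show ?thesis
            using True less.prems[OF ji] by (simp add: y'_def)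
        next
          case False
          then show ?thesis
            using out[OF False] y'_ge[of i] by (simp add: y'_def)
        qed
      qed auto
      \<comment> \<open>If \<open>y (c j)\<close> exceeds \<open>m\<close>, so does \<open>y\<close>
        on all of \<open>S j\<close>; this reduces the claim to the constraint at \<open>?I\<close>,
        a proper subset since it omits \<open>i0\<close>.\<close>
      moreover have "(\<Sum>j\<in>J. of_bool (c j \<in> ?I)) \<le> (\<Sum>i\<in>?I. t $ i)"
      proof -
        have "(\<Sum>j\<in>J. of_bool (c j \<in> ?I)) \<le> (\<Sum>j\<in>J. of_bool (S j \<subseteq> ?I) :: real)"
        proof (rule sum_mono)
          fix j assume j: "j \<in> J"
          have "S j \<subseteq> ?I" if "c j \<in> ?I"
            using that less.prems[OF j] by fastforce
          then show "of_bool (c j \<in> ?I) \<le> (of_bool (S j \<subseteq> ?I) :: real)"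
            by auto
        qed
        also have "\<dots> \<le> (\<Sum>i\<in>?I. t $ i)"
        proof -
          have "?I \<noteq> UNIV"
            using i0 less_irrefl by (metis UNIV_I mem_Collect_eq)
          then show ?thesis
            by (rule t_ge)
        qed
        finally show ?thesis .
      qed
      moreover have "(\<Sum>j\<in>J. y (c j)) = (\<Sum>j\<in>J. y' (c j)) + \<delta> * (\<Sum>j\<in>J. of_bool (c j \<in> ?I))"
        by (simp add: y'_def sum_subtractf flip: sum_distrib_left)
      moreover have "(\<Sum>i\<in>UNIV. y i * t $ i) = (\<Sum>i\<in>UNIV. y' i * t $ i) + \<delta> * (\<Sum>i\<in>?I. t $ i)"
      proof -
        have "(\<Sum>i\<in>?I. t $ i) = (\<Sum>i\<in>UNIV. of_bool (i \<in> ?I) * t $ i)"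
          by (rule sum.mono_neutral_cong_left) auto
        then show ?thesis
          by (simp add: y'_def left_diff_distrib sum_subtractf mult.assoc flip: sum_distrib_left)
      qed
      ultimately show ?thesis
        using \<delta> by (simp only: add_mono mult_left_mono less_imp_le)
    qed
  qed
qed

section \<open>The two inclusions between the polytopes\<close>

lemma convex_generalized_permutahedron:
  fixes z :: "'n::finite set \<Rightarrow> real"
  shows "convex (generalized_permutahedron z)"
proof -
  have half: "convex {t :: real ^ 'n. z I \<le> (\<Sum>i\<in>I. t $ i)}"
    and hyper: "convex {t :: real ^ 'n. (\<Sum>i\<in>I. t $ i) = z I}" for I
  proof -
    have "linear (\<lambda>t :: real ^ 'n. \<Sum>i\<in>I. t $ i)"
      by (auto intro!: linearI simp: sum.distrib sum_distrib_left)
    then show "convex {t :: real ^ 'n. z I \<le> (\<Sum>i\<in>I. t $ i)}"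
      "convex {t :: real ^ 'n. (\<Sum>i\<in>I. t $ i) = z I}"
      using convex_linear_vimage[of "\<lambda>t. \<Sum>i\<in>I. t $ i" "{z I..}"]
        convex_linear_vimage[of "\<lambda>t. \<Sum>i\<in>I. t $ i" "{z I}"]
      by (simp_all add: vimage_def)
  qed
  have "generalized_permutahedron z =
      (\<Inter>I\<in>- {UNIV}. {t. z I \<le> (\<Sum>i\<in>I. t $ i)}) \<inter> {t. (\<Sum>i\<in>UNIV. t $ i) = z UNIV}"
    by (auto simp: generalized_permutahedron_def)
  then show ?thesis
    by (simp only:) (intro convex_Int convex_INT half hyper)
qed

theorem theorem3p19:
  fixes w :: "'n::{finite,linorder} \<Rightarrow> 'n"
  assumes "w permutes UNIV"
  shows "newton_polytope (dual_schubert w) =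
    generalized_permutahedron (\<lambda>I. \<Sum>(a, b)\<in>inversions w. of_bool (I \<supseteq> {a..<b}))"
proof
  have z: "(\<Sum>(a, b)\<in>inversions w. of_bool (I \<supseteq> {a..<b})) = real (card (inversions_in I w))" for I
    by (simp add: inversions_in_def case_prod_unfold Collect_conj_eq flip: Int_def)
  have "(\<chi> i. real (Poly_Mapping.lookup e i)) \<in>
      generalized_permutahedron (\<lambda>I. \<Sum>(a, b)\<in>inversions w. of_bool (I \<supseteq> {a..<b}))"
    if e: "e \<in> Poly_Mapping.keys (dual_schubert w)" for e
  proof -
    obtain C where C: "C \<in> saturated_chains id w" and eC: "e \<in> Poly_Mapping.keys (chain_weight C)"
      using e by (auto simp: keys_dual_schubert)
    have C': "successively bruhat_cover C" "C \<noteq> []" "hd C = id" "last C = w"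
      using C by (auto simp: saturated_chains_def)
    \<comment> \<open>Chains start at the identity, which adds nothing to the bounds.\<close>
    have id: "inversions_in I id = {}" "perm_length (id :: 'n \<Rightarrow> 'n) = 0" for I :: "'n set"
      by (auto simp: inversions_in_def perm_length_def inversions_def)
    have "card (inversions_in I w) \<le> (\<Sum>i\<in>I. Poly_Mapping.lookup e i)"
      "perm_length w = (\<Sum>i\<in>UNIV. Poly_Mapping.lookup e i)" for I
      using chain_exponent_bounds[OF C'(1,2) _ eC] C'(3,4) by (auto simp: permutes_id id)
    \<comment> \<open>For \<open>I = UNIV\<close> the number \<open>z_I\<close> is the length, the
      total degree of every exponent.\<close>
    moreover have "inversions_in UNIV w = inversions w"
      by (auto simp: inversions_in_def)
    ultimately show ?thesis
      unfolding z generalized_permutahedron_def by (simp add: perm_length_def flip: of_nat_sum)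
  qed
  then show "newton_polytope (dual_schubert w) \<subseteq>
      generalized_permutahedron (\<lambda>I. \<Sum>(a, b)\<in>inversions w. of_bool (I \<supseteq> {a..<b}))"
    unfolding newton_polytope_def
    by (intro hull_minimal convex_generalized_permutahedron) auto
next
  show "generalized_permutahedron (\<lambda>I. \<Sum>(a, b)\<in>inversions w. of_bool (I \<supseteq> {a..<b})) \<subseteq>
      newton_polytope (dual_schubert w)"
  proof (rule subsetI, rule ccontr)
    fix t
    assume t: "t \<in> generalized_permutahedron (\<lambda>I. \<Sum>(a, b)\<in>inversions w. of_bool (I \<supseteq> {a..<b}))"
      and "t \<notin> newton_polytope (dual_schubert w)"
    moreover have "convex (newton_polytope (dual_schubert w))"
      "closed (newton_polytope (dual_schubert w))"
      unfolding newton_polytope_def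
      by (auto intro!: compact_imp_closed finite_imp_compact_convex_hull)
    ultimately obtain y \<beta> where y: "y \<bullet> t < \<beta>"
      "\<And>s. s \<in> newton_polytope (dual_schubert w) \<Longrightarrow> \<beta> < y \<bullet> s"
      using separating_hyperplane_closed_point[of "newton_polytope (dual_schubert w)" t] by auto
    \<comment> \<open>On the interval of each inversion, \<open>c\<close> picks a minimiser of the
      separating functional \<open>y\<close>. The resulting exponent \<open>e\<close> lies in the
      Newton polytope, yet its \<open>y\<close>-value is at most that of \<open>t\<close>.\<close>
    define c where "c p = arg_min_on (($) y) {fst p..<snd p}" for p
    have c: "c p \<in> {fst p..<snd p}" "i \<in> {fst p..<snd p} \<Longrightarrow> y $ c p \<le> y $ i"
      if "p \<in> inversions w" for p i
    proof -
      have "{fst p..<snd p} \<noteq> {}"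
        using that by (auto simp: inversions_def)
      then show "c p \<in> {fst p..<snd p}" "i \<in> {fst p..<snd p} \<Longrightarrow> y $ c p \<le> y $ i"
        unfolding c_def using arg_min_if_finite(1)[of "{fst p..<snd p}"]
          arg_min_least[of "{fst p..<snd p}"] by (blast intro: finite)+
    qed
    define e where "e = (\<Sum>p\<in>inversions w. Poly_Mapping.single (c p) (1::nat))"
    have "e \<in> Poly_Mapping.keys (dual_schubert w)"
      using weak_order_chain[OF assms, of c] c(1) by (fastforce simp: keys_dual_schubert e_def)
    then have "(\<chi> i. real (Poly_Mapping.lookup e i)) \<in> newton_polytope (dual_schubert w)"
      unfolding newton_polytope_def by (intro hull_inc) auto
    then have "\<beta> < (\<Sum>i\<in>UNIV. y $ i * real (Poly_Mapping.lookup e i))"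
      using y(2) by (fastforce simp: inner_vec_def)
    also have "\<dots> = (\<Sum>p\<in>inversions w. \<Sum>i\<in>UNIV. if c p = i then y $ i else 0)"
      unfolding e_def lookup_sum lookup_single when_def of_nat_sum sum_distrib_left
      by (subst sum.swap) (intro sum.cong refl, simp)
    also have "\<dots> = (\<Sum>p\<in>inversions w. y $ c p)"
      by simp
    also have "\<dots> \<le> (\<Sum>i\<in>UNIV. y $ i * t $ i)"
      using t c by (intro generalized_permutahedron_inner_ge[where S = "\<lambda>p. {fst p..<snd p}"])
        (auto simp: case_prod_unfold)
    finally show False
      using y(1) by (simp add: inner_vec_def)
  qed
qed

end
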